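(* Let $d\ge 2$ be an integer and let $t>0$. Let $\boldsymbol{A}\in\mathbb{R}^{d\times d}$ be the matrix with columns $\boldsymbol{0},\boldsymbol{e}_1,\dots,\boldsymbol{e}_{d-1}$, let $\boldsymbol{b}=\boldsymbol{e}_d$, and let $$\boldsymbol{\xi}(s)=\left(\frac{s^{d-1}}{(d-1)!},\ \frac{s^{d-2}}{(d-2)!},\ \dots,\ s,\ 1\right)^{\top}\in\mathbb{R}^d .$$ (i) For every integer $n\ge1$, with $t_i=it/n$ for $i=0,1,\dots,n$, the Minkowski sum $\sum_{i=0}^{n}\exp(t_i\boldsymbol{A})\boldsymbol{b}\,[-1,1]$ is the zonotope $\mathcal{Z}_{n+1}\left(\{\boldsymbol{\xi}(t_i)\}_{i=0}^{n}\right)$ generated by the $n+1$ vectors $\boldsymbol{\xi}(t_0),\dots,\boldsymbol{\xi}(t_n)$, and its support function is $$h_{\mathcal{Z}_{n+1}(\{\boldsymbol{\xi}(t_i)\}_{i=0}^{n})}(\boldsymbol{y})=\sum_{i=0}^{n}|\langle\boldsymbol{y},\boldsymbol{\xi}(t_i)\rangle|,\qquad \boldsymbol{y}\in\mathbb{R}^d .$$ (ii) The limiting compact convex set $\int_0^t\exp(s\boldsymbol{A})\boldsymbol{b}\,[-1,1]\,ds$ is a zonoid.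
   Context: $\boldsymbol{e}_i$ is the $i$-th standard basis column vector of $\mathbb{R}^d$. For a vector $\boldsymbol{v}$, $\boldsymbol{v}[-1,1]$ denotes the segment $\{\gamma\boldsymbol{v}:\gamma\in[-1,1]\}$. Support function: for a compact convex set $\mathcal{K}\subset\mathbb{R}^d$, $h_{\mathcal{K}}(\boldsymbol{y})=\sup_{\boldsymbol{x}\in\mathcal{K}}\langle\boldsymbol{y},\boldsymbol{x}\rangle$, $\boldsymbol{y}\in\mathbb{R}^d$. Zonotope: the zonotope generated by vectors $\boldsymbol{v}_1,\dots,\boldsymbol{v}_m\in\mathbb{R}^d$ is the Minkowski sum of line segments $\mathcal{Z}_m(\{\boldsymbol{v}_j\}_{j=1}^m)=\{\sum_{j=1}^m\gamma_j\boldsymbol{v}_j:\gamma_j\in[-1,1],\ j=1,\dots,m\}$. Zonoid: a compact convex subset of $\mathbb{R}^d$ that is the limit, in the Hausdorff metric, of a sequence of zonotopes. Set-valued integral: for a set-valued function $F$ on $[0,t]$, $\int_0^tF(s)\,ds:=\lim_{\Delta\downarrow0}\sum_{i=0}^{\lfloor t/\Delta\rfloor}\Delta F(i\Delta)$, where the sum is a Minkowski sum, $\Delta F(i\Delta)$ is the set $F(i\Delta)$ scaled by $\Delta$, and the limit is in the Hausdorff metric. *)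

theory Defs
  imports "HOL-Analysis.Analysis"
begin

text \<open>
  Sums of sets, \<open>A + B\<close> and \<open>\<Sum>i\<in>I. A i\<close>, are the pointwise ones of
  \<open>HOL-Library.Set_Algebras\<close>, i.e. Minkowski sums.
\<close>

definition symmetric_segment :: "'a::real_vector \<Rightarrow> 'a set" where
  "symmetric_segment v = {\<gamma> *\<^sub>R v | \<gamma>::real. \<gamma> \<in> {-1..1}}"

definition zonotope :: "nat \<Rightarrow> (nat \<Rightarrow> 'a::real_vector) \<Rightarrow> 'a set" where
  "zonotope m v = {(\<Sum>j<m. \<gamma> j *\<^sub>R v j) | \<gamma> :: nat \<Rightarrow> real. \<forall>j<m. \<gamma> j \<in> {-1..1}}"

definition is_zonotope :: "'a::real_vector set \<Rightarrow> bool" where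
  "is_zonotope Z \<longleftrightarrow> (\<exists>m v. Z = zonotope m v)"

text \<open>Intended for nonempty compact sets, so that the supremum is a genuine one.\<close>

definition support_function :: "'a::real_inner set \<Rightarrow> 'a \<Rightarrow> real" where
  "support_function K y = (SUP x\<in>K. y \<bullet> x)"

text \<open>
  On unbounded or empty sets the value of \<open>hausdorff_distance\<close> is meaningless;
  convergence is therefore restricted to nonempty compact sets, where it is the
  Hausdorff metric.
\<close>

definition hausdorff_distance :: "'a::metric_space set \<Rightarrow> 'a set \<Rightarrow> real" where
  "hausdorff_distance A B = max (SUP a\<in>A. infdist a B) (SUP b\<in>B. infdist b A)"

definition hausdorff_tendsto ::
    "('b \<Rightarrow> 'a::metric_space set) \<Rightarrow> 'a set \<Rightarrow> 'b filter \<Rightarrow> bool" where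
  "hausdorff_tendsto F K net \<longleftrightarrow>
     compact K \<and> K \<noteq> {} \<and> (\<forall>\<^sub>F x in net. compact (F x) \<and> F x \<noteq> {}) \<and>
     ((\<lambda>x. hausdorff_distance (F x) K) \<longlongrightarrow> 0) net"

definition zonoid :: "'a::real_normed_vector set \<Rightarrow> bool" where
  "zonoid K \<longleftrightarrow> compact K \<and> convex K \<and>
     (\<exists>Z :: nat \<Rightarrow> 'a set. (\<forall>n. is_zonotope (Z n)) \<and> hausdorff_tendsto Z K sequentially)"

definition has_set_valued_integral ::
    "(real \<Rightarrow> 'a::real_normed_vector set) \<Rightarrow> real \<Rightarrow> 'a set \<Rightarrow> bool" where
  "has_set_valued_integral F t K \<longleftrightarrow>
     hausdorff_tendsto (\<lambda>\<Delta>. \<Sum>i\<le>nat \<lfloor>t / \<Delta>\<rfloor>. (*\<^sub>R) \<Delta> ` F (real i * \<Delta>)) K (at_right 0)"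

definition set_valued_integral ::
    "(real \<Rightarrow> 'a::real_normed_vector set) \<Rightarrow> real \<Rightarrow> 'a set" where
  "set_valued_integral F t = (THE K. has_set_valued_integral F t K)"

text \<open>
  The library's \<open>exp\<close> does not apply here: multiplication on the type
  \<^typ>\<open>real^'n^'n\<close> is componentwise, the matrix product being \<open>**\<close>.
\<close>

primrec matrix_power :: "real^'n^'n \<Rightarrow> nat \<Rightarrow> real^'n^'n" where
  "matrix_power A 0 = mat 1"
| "matrix_power A (Suc k) = A ** matrix_power A k"

definition matrix_exp :: "real^'n^'n \<Rightarrow> real^'n^'n" where
  "matrix_exp A = (\<Sum>k. (1 / fact k) *\<^sub>R matrix_power A k)"

end

theory Submission
  imports Defs
begin

text \<open>
  Since the shift \<open>A\<close> satisfies \<open>A\<^sup>k b = e\<^bsub>d-k\<^esub>\<close>, the exponential series gives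
  \<open>exp (s A) b = \<xi> s\<close>, so each sum of segments is a zonotope. The limit set is the closure of
  \<open>{\<integral>\<gamma>(s) g(s) ds}\<close> over measurable multipliers with \<open>\<bar>\<gamma>\<bar> \<le> 1\<close>, where \<open>g = \<xi>\<close>:
  averaging \<open>\<gamma>\<close> over the cells of a partition turns such an integral into a nearby point of the
  Riemann zonotope, and a point of the zonotope gives a step function \<open>\<gamma>\<close>. The error is bounded
  by the modulus of continuity of \<open>g\<close>, uniformly in \<open>\<gamma>\<close>, which is Hausdorff convergence.
\<close>

section \<open>The Hausdorff distance of compact sets\<close>

text \<open>The real supremum bounds its members only when the set is bounded above; this supplies
  that for both suprema in \<open>hausdorff_distance\<close>.\<close>

lemma bdd_above_infdist_image:
  assumes "bounded A"
  shows "bdd_above ((\<lambda>a. infdist a B) ` A)"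
proof (cases "B = {}")
  case True
  \<comment> \<open>By convention \<open>infdist\<close> to the empty set is 0.\<close>
  then show ?thesis by (auto simp: infdist_def)
next
  case False
  then obtain b where "b \<in> B" by blast
  obtain e where "\<forall>a\<in>A. dist b a \<le> e"
    using assms bounded_any_center by metis
  with \<open>b \<in> B\<close> show ?thesis
    by (intro bdd_aboveI2[where M = e]) (auto intro: infdist_le2 simp: dist_commute)
qed

lemma infdist_le_hausdorff_distance:
  assumes "compact A" "compact B"
  shows "a \<in> A \<Longrightarrow> infdist a B \<le> hausdorff_distance A B"
    and "b \<in> B \<Longrightarrow> infdist b A \<le> hausdorff_distance A B"
proof -
  assume "a \<in> A"
  then have "infdist a B \<le> (SUP a\<in>A. infdist a B)"
    by (intro cSUP_upper bdd_above_infdist_image compact_imp_bounded assms)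
  then show "infdist a B \<le> hausdorff_distance A B"
    by (simp add: hausdorff_distance_def)
next
  assume "b \<in> B"
  then have "infdist b A \<le> (SUP b\<in>B. infdist b A)"
    by (intro cSUP_upper bdd_above_infdist_image compact_imp_bounded assms)
  then show "infdist b A \<le> hausdorff_distance A B"
    by (simp add: hausdorff_distance_def)
qed

lemma hausdorff_distance_nonneg:
  assumes "compact A" "compact B" "A \<noteq> {}"
  shows "0 \<le> hausdorff_distance A B"
  using assms infdist_le_hausdorff_distance(1)[OF assms(1,2)] infdist_nonneg
  by (metis all_not_in_conv order_trans)

lemma hausdorff_distance_leI:
  assumes "A \<noteq> {}" "B \<noteq> {}"
    and "\<And>a. a \<in> A \<Longrightarrow> infdist a B \<le> e"
    and "\<And>b. b \<in> B \<Longrightarrow> infdist b A \<le> e"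
  shows "hausdorff_distance A B \<le> e"
  unfolding hausdorff_distance_def using assms by (auto intro: cSUP_least)

text \<open>Half of the triangle inequality for the Hausdorff distance:
  \<open>infdist a C \<le> dist a b + e\<close> for each \<open>b\<close> in \<open>B\<close>,
  followed by the infimum over \<open>b\<close>.\<close>

lemma infdist_le_infdist_add:
  assumes "B \<noteq> {}" and "\<And>b. b \<in> B \<Longrightarrow> infdist b C \<le> e"
  shows "infdist a C \<le> infdist a B + e"
proof -
  have "infdist a C - e \<le> dist a b" if "b \<in> B" for b
    using infdist_triangle[of a C b] assms(2)[OF that] by simp
  then have "infdist a C - e \<le> infdist a B"
    unfolding infdist_notempty[OF assms(1)] by (intro cINF_greatest assms(1))
  then show ?thesis by simp
qed

text \<open>A point of \<open>K\<close> is close to \<open>F n\<close>, and \<open>F n\<close> is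
  close to \<open>L\<close>, so its distance to \<open>L\<close> is below a quantity tending to 0.
  As \<open>L\<close> is closed, the point lies in it. Exchanging \<open>K\<close> and
  \<open>L\<close> then gives uniqueness of limits.\<close>

lemma hausdorff_tendsto_subset:
  assumes K: "hausdorff_tendsto F K net" and L: "hausdorff_tendsto F L net"
    and "net \<noteq> bot"
  shows "K \<subseteq> L"
proof
  fix x assume "x \<in> K"
  have c: "compact K" "compact L" "L \<noteq> {}"
    using K L by (auto simp: hausdorff_tendsto_def)
  have "((\<lambda>n. hausdorff_distance (F n) K + hausdorff_distance (F n) L) \<longlongrightarrow> 0 + 0) net"
    using K L by (intro tendsto_add) (auto simp: hausdorff_tendsto_def)
  moreover have "\<forall>\<^sub>F n in net. compact (F n) \<and> F n \<noteq> {}"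
    using K by (simp add: hausdorff_tendsto_def)
  then have "\<forall>\<^sub>F n in net. infdist x L \<le> hausdorff_distance (F n) K + hausdorff_distance (F n) L"
  proof eventually_elim
    case (elim n)
    have "infdist x L \<le> infdist x (F n) + hausdorff_distance (F n) L"
      using elim c by (intro infdist_le_infdist_add infdist_le_hausdorff_distance) auto
    also have "infdist x (F n) \<le> hausdorff_distance (F n) K"
      using elim c \<open>x \<in> K\<close> by (intro infdist_le_hausdorff_distance) auto
    finally show ?case by simp
  qed
  ultimately have "infdist x L \<le> 0 + 0"
    using \<open>net \<noteq> bot\<close> by (rule tendsto_lowerbound)
  then have "infdist x L = 0"
    using infdist_nonneg[of x L] by simp
  then show "x \<in> L"
    using c in_closed_iff_infdist_zero compact_imp_closed by blast
qed

lemma hausdorff_tendsto_unique: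
  assumes "hausdorff_tendsto F K net" "hausdorff_tendsto F L net" "net \<noteq> bot"
  shows "K = L"
  using assms hausdorff_tendsto_subset by (metis subset_antisym)

lemma hausdorff_tendsto_compose:
  assumes "hausdorff_tendsto F K net" "filterlim u net net'"
  shows "hausdorff_tendsto (\<lambda>x. F (u x)) K net'"
  using assms unfolding hausdorff_tendsto_def
  by (auto elim: eventually_compose_filterlim filterlim_compose)

text \<open>Limits along the nontrivial filter \<open>at_right 0\<close> are unique, so the definite
  description picks out any limit that has been exhibited.\<close>

lemma set_valued_integral_eqI:
  assumes "has_set_valued_integral F t K"
  shows "set_valued_integral F t = K"
  unfolding set_valued_integral_def
proof (rule the_equality)
  show "L = K" if "has_set_valued_integral F t L" for L
    using hausdorff_tendsto_unique[of _ L "at_right (0::real)" K] that assms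
    by (simp add: has_set_valued_integral_def)
qed (rule assms)

section \<open>Zonotopes\<close>

lemma zonotopeI:
  assumes "\<And>j. j < m \<Longrightarrow> \<bar>\<gamma> j\<bar> \<le> 1"
  shows "(\<Sum>j<m. \<gamma> j *\<^sub>R v j) \<in> zonotope m v"
  unfolding zonotope_def using assms
  by (intro CollectI exI[of _ \<gamma>]) (auto simp: abs_le_iff minus_le_iff)

text \<open>Choosing one point in each segment amounts to choosing one coefficient for each
  generator; the indices 0 to \<open>n\<close> give \<open>Suc n\<close> generators.\<close>

lemma sum_symmetric_segment_eq_zonotope:
  "(\<Sum>i\<le>n. symmetric_segment (v i)) = zonotope (Suc n) v"
proof -
  have "sum s {..n} \<in> zonotope (Suc n) v"
    if "\<forall>i\<in>{..n}. s i \<in> symmetric_segment (v i)" for s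
  proof -
    from that obtain \<gamma> where "\<forall>i\<in>{..n}. s i = \<gamma> i *\<^sub>R v i \<and> \<gamma> i \<in> {-1..1::real}"
      unfolding symmetric_segment_def mem_Collect_eq by metis
    then show ?thesis
      unfolding zonotope_def
      by (auto intro!: exI[of _ \<gamma>] sum.cong simp: lessThan_Suc_atMost)
  qed
  moreover have "\<exists>s. x = sum s {..n} \<and> (\<forall>i\<in>{..n}. s i \<in> symmetric_segment (v i))"
    if x: "x \<in> zonotope (Suc n) v" for x
  proof -
    from x obtain \<gamma> :: "nat \<Rightarrow> real" where "x = (\<Sum>j<Suc n. \<gamma> j *\<^sub>R v j)" "\<forall>j<Suc n. \<gamma> j \<in> {-1..1}"
      unfolding zonotope_def by blast
    then show ?thesis
      unfolding symmetric_segment_def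
      by (intro exI[of _ "\<lambda>j. \<gamma> j *\<^sub>R v j"]) (auto simp: lessThan_Suc_atMost)
  qed
  ultimately show ?thesis
    by (auto simp: set_sum_alt)
qed

lemma symmetric_segment_eq_image: "symmetric_segment v = (\<lambda>\<gamma>. \<gamma> *\<^sub>R v) ` {-1..1}"
  by (auto simp: symmetric_segment_def)

lemma scaleR_image_symmetric_segment:
  "(*\<^sub>R) r ` symmetric_segment v = symmetric_segment (r *\<^sub>R v)"
  by (simp add: symmetric_segment_eq_image image_image mult.commute)

lemma compact_symmetric_segment:
  fixes v :: "'a::real_normed_vector"
  shows "compact (symmetric_segment v)"
  unfolding symmetric_segment_eq_image by (auto intro!: compact_continuous_image continuous_intros)

lemma compact_set_sum:
  fixes S :: "'i \<Rightarrow> 'a::real_normed_vector set"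
  assumes "\<And>i. i \<in> I \<Longrightarrow> compact (S i)"
  shows "compact (sum S I)"
  using assms
proof (induction I rule: infinite_finite_induct)
  case (insert i I)
  have "sum S (insert i I) = {x + y |x y. x \<in> S i \<and> y \<in> sum S I}"
    using insert.hyps by (auto simp: set_plus_def)
  with insert show ?case
    by (simp add: compact_sums)
\<comment> \<open>Over an empty or infinite index set the sum is 0, which for sets means the
  singleton of 0.\<close>
qed (simp_all add: set_zero)

lemma zonotope_nonempty: "zonotope m v \<noteq> {}"
  using zonotopeI[of m "\<lambda>_. 0" v] by auto

text \<open>The supremum is attained: the coefficients \<open>sgn (y \<bullet> v j)\<close> maximise
  every summand at once.\<close>

lemma support_function_zonotope:
  "support_function (zonotope m v) y = (\<Sum>j<m. \<bar>y \<bullet> v j\<bar>)"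
  unfolding support_function_def
proof (rule cSup_eq_maximum)
  have "y \<bullet> (\<Sum>j<m. sgn (y \<bullet> v j) *\<^sub>R v j) = (\<Sum>j<m. \<bar>y \<bullet> v j\<bar>)"
    unfolding inner_sum_right inner_scaleR_right by (intro sum.cong) (simp_all add: sgn_if)
  moreover have "(\<Sum>j<m. sgn (y \<bullet> v j) *\<^sub>R v j) \<in> zonotope m v"
    by (rule zonotopeI) (simp add: abs_sgn_eq)
  ultimately show "(\<Sum>j<m. \<bar>y \<bullet> v j\<bar>) \<in> (\<bullet>) y ` zonotope m v"
    by (rule image_eqI[OF sym])
next
  fix z assume "z \<in> (\<bullet>) y ` zonotope m v"
  then obtain \<gamma> :: "nat \<Rightarrow> real" where \<gamma>: "\<forall>j<m. \<gamma> j \<in> {-1..1}"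
    and z: "z = (\<Sum>j<m. \<gamma> j * (y \<bullet> v j))"
    unfolding zonotope_def by (auto simp: inner_sum_right)
  have "\<gamma> j * (y \<bullet> v j) \<le> \<bar>y \<bullet> v j\<bar>" if "j < m" for j
  proof -
    have "\<bar>\<gamma> j\<bar> \<le> 1" using \<gamma> that by auto
    then have "\<bar>\<gamma> j * (y \<bullet> v j)\<bar> \<le> \<bar>y \<bullet> v j\<bar>"
      by (simp add: abs_mult mult_left_le_one_le)
    then show ?thesis by linarith
  qed
  then show "z \<le> (\<Sum>j<m. \<bar>y \<bullet> v j\<bar>)"
    unfolding z by (intro sum_mono) auto
qed

section \<open>The set-valued integral of a segment along a continuous curve\<close>

text \<open>This is the Aumann integral of the segments along \<open>g\<close>, with selections
  written as multiplier times \<open>g\<close>. Multipliers live on the whole line, so they can be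
  averaged over a cell that sticks out of \<open>{0..t}\<close>.\<close>

definition multiplier_integrals :: "(real \<Rightarrow> 'a::euclidean_space) \<Rightarrow> real \<Rightarrow> 'a set" where
  "multiplier_integrals g t =
     {integral {0..t} (\<lambda>s. \<gamma> s *\<^sub>R g s) |\<gamma>. \<gamma> \<in> borel_measurable borel \<and> (\<forall>s. \<bar>\<gamma> s\<bar> \<le> 1)}"

lemma integrable_multiplier:
  fixes g :: "real \<Rightarrow> 'a::euclidean_space"
  assumes \<gamma>: "\<gamma> \<in> borel_measurable borel" "\<And>s. \<bar>\<gamma> s\<bar> \<le> 1"
    and g: "continuous_on {a..b} g"
  shows "(\<lambda>s. \<gamma> s *\<^sub>R g s) integrable_on {a..b}"
proof (rule measurable_bounded_by_integrable_imp_integrable)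
  have "\<gamma> \<in> borel_measurable (lebesgue_on {a..b})"
    using \<gamma>(1) by (simp add: borel_measurable_if_D measurable_completion measurable_restrict_space1)
  moreover have "g \<in> borel_measurable (lebesgue_on {a..b})"
    using g by (intro continuous_imp_measurable_on_sets_lebesgue) auto
  ultimately show "(\<lambda>s. \<gamma> s *\<^sub>R g s) \<in> borel_measurable (lebesgue_on {a..b})"
    by (rule borel_measurable_scaleR)
  show "(\<lambda>s. norm (g s)) integrable_on {a..b}"
    using g by (intro integrable_continuous_interval continuous_intros)
  show "norm (\<gamma> s *\<^sub>R g s) \<le> norm (g s)" for s
    using \<gamma>(2)[of s] by (simp add: mult_left_le_one_le)
qed simp

section \<open>Error of Riemann sums against integrals with a multiplier\<close>

lemma norm_integral_le:
  fixes f :: "real \<Rightarrow> 'a::euclidean_space"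
  assumes "f integrable_on {a..b}" "a \<le> b" "\<And>s. s \<in> {a..b} \<Longrightarrow> norm (f s) \<le> B"
  shows "norm (integral {a..b} f) \<le> B * (b - a)"
  using integral_norm_bound_integral[OF assms(1) integrable_const_ivl, of B] assms(2,3)
  by (simp add: mult.commute)

lemma norm_multiplier_le: "\<bar>c\<bar> \<le> 1 \<Longrightarrow> norm x \<le> B \<Longrightarrow> norm (c *\<^sub>R x) \<le> B"
  by (smt (verit) mult_left_le_one_le norm_ge_zero norm_scaleR)

text \<open>If \<open>g\<close> is frozen at the left end of each cell, the integral over the cell
  equals the summand exactly, since \<open>c i\<close> is the mean of \<open>\<gamma>\<close> there.
  What remains is the variation of \<open>g\<close> on the cell, at most \<open>\<omega>\<close>
  over a length \<open>h\<close>.\<close>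

lemma norm_integral_minus_sum_le:
  fixes g :: "real \<Rightarrow> 'a::euclidean_space"
  assumes \<gamma>: "\<gamma> \<in> borel_measurable borel" "\<And>s. \<bar>\<gamma> s\<bar> \<le> 1"
    and g: "continuous_on {0..real n * h} g" and "h > 0"
    and \<omega>: "\<And>s s'. s \<in> {0..real n * h} \<Longrightarrow> s' \<in> {0..real n * h} \<Longrightarrow> \<bar>s - s'\<bar> \<le> h \<Longrightarrow>
              norm (g s - g s') \<le> \<omega>"
    and c: "\<And>i. i < n \<Longrightarrow> integral {real i * h..real (Suc i) * h} \<gamma> = c i * h"
  shows "norm (integral {0..real n * h} (\<lambda>s. \<gamma> s *\<^sub>R g s) - (\<Sum>i<n. c i *\<^sub>R h *\<^sub>R g (real i * h)))
           \<le> \<omega> * (real n * h)"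
  using g \<omega> c
proof (induction n)
  case 0
  then show ?case by simp
next
  case (Suc n)
  let ?a = "real n * h" and ?b = "real (Suc n) * h"
  let ?f = "\<lambda>s. \<gamma> s *\<^sub>R g s"
  let ?S = "\<lambda>n. \<Sum>i<n. c i *\<^sub>R h *\<^sub>R g (real i * h)"
  have ab: "0 \<le> ?a" "?a \<le> ?b" "?b - ?a = h"
    using \<open>h > 0\<close> by (auto simp: algebra_simps)
  have IH: "norm (integral {0..?a} ?f - ?S n) \<le> \<omega> * ?a"
    using ab Suc.prems by (intro Suc.IH continuous_on_subset[OF Suc.prems(1)]) auto
  have gab: "continuous_on {?a..?b} g"
    using ab by (intro continuous_on_subset[OF Suc.prems(1)]) auto
  have int_f: "?f integrable_on {?a..?b}"
    by (intro integrable_multiplier \<gamma> gab)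
  have int_\<gamma>: "\<gamma> integrable_on {?a..?b}"
    using integrable_multiplier[OF \<gamma>, of ?a ?b "\<lambda>_. 1::real"] by simp
  have "integral {?a..?b} ?f - c n *\<^sub>R h *\<^sub>R g ?a = integral {?a..?b} (\<lambda>s. \<gamma> s *\<^sub>R (g s - g ?a))"
  proof -
    have "((\<lambda>s. \<gamma> s *\<^sub>R g ?a) has_integral (c n * h) *\<^sub>R g ?a) {?a..?b}"
      using Suc.prems(3)[of n] int_\<gamma> by (metis has_integral_integral has_integral_scaleR_left lessI)
    then have "((\<lambda>s. ?f s - \<gamma> s *\<^sub>R g ?a) has_integral
        (integral {?a..?b} ?f - (c n * h) *\<^sub>R g ?a)) {?a..?b}"
      using int_f by (intro has_integral_diff) auto
    then show ?thesis
      by (simp add: integral_unique scaleR_diff_right)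
  qed
  also have "norm \<dots> \<le> \<omega> * (?b - ?a)"
  proof (rule norm_integral_le)
    show "(\<lambda>s. \<gamma> s *\<^sub>R (g s - g ?a)) integrable_on {?a..?b}"
      by (intro integrable_multiplier \<gamma> continuous_intros gab)
    show "norm (\<gamma> s *\<^sub>R (g s - g ?a)) \<le> \<omega>" if "s \<in> {?a..?b}" for s
      using that ab order_trans[OF ab(1), of s] by (intro norm_multiplier_le \<gamma> Suc.prems(2)) auto
  qed (rule ab)
  finally have step: "norm (integral {?a..?b} ?f - c n *\<^sub>R h *\<^sub>R g ?a) \<le> \<omega> * h"
    using ab by simp
  have "integral {0..?b} ?f = integral {0..?a} ?f + integral {?a..?b} ?f"
    using ab by (intro Henstock_Kurzweil_Integration.integral_combine[symmetric]
        integrable_multiplier \<gamma> Suc.prems) auto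
  then have "integral {0..?b} ?f - ?S (Suc n)
      = (integral {0..?a} ?f - ?S n) + (integral {?a..?b} ?f - c n *\<^sub>R h *\<^sub>R g ?a)"
    by simp
  also have "norm \<dots> \<le> \<omega> * ?a + \<omega> * h"
    by (rule norm_triangle_mono[OF IH step])
  finally show ?case
    by (simp add: algebra_simps)
qed

text \<open>The floor sum differs from a sum over full cells in two ways, each costing at most
  \<open>M * h\<close>: the remaining piece of \<open>{0..t}\<close> is no longer than
  \<open>h\<close>, and the summand with the top index belongs to no full cell.\<close>

lemma norm_integral_minus_floor_sum_le:
  fixes g :: "real \<Rightarrow> 'a::euclidean_space"
  assumes \<gamma>: "\<gamma> \<in> borel_measurable borel" "\<And>s. \<bar>\<gamma> s\<bar> \<le> 1"
    and g: "continuous_on {0..t} g" and t: "t \<ge> 0" and h: "h > 0"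
    and M: "\<And>s. s \<in> {0..t} \<Longrightarrow> norm (g s) \<le> M"
    and \<omega>: "\<And>s s'. s \<in> {0..t} \<Longrightarrow> s' \<in> {0..t} \<Longrightarrow> \<bar>s - s'\<bar> \<le> h \<Longrightarrow> norm (g s - g s') \<le> \<omega>"
    and c: "\<And>i. i < nat \<lfloor>t / h\<rfloor> \<Longrightarrow> integral {real i * h..real (Suc i) * h} \<gamma> = c i * h"
      "\<bar>c (nat \<lfloor>t / h\<rfloor>)\<bar> \<le> 1"
  shows "norm (integral {0..t} (\<lambda>s. \<gamma> s *\<^sub>R g s)
           - (\<Sum>i\<le>nat \<lfloor>t / h\<rfloor>. c i *\<^sub>R h *\<^sub>R g (real i * h))) \<le> \<omega> * t + 2 * M * h"
proof -
  define n where "n = nat \<lfloor>t / h\<rfloor>"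
  let ?a = "real n * h"
  let ?f = "\<lambda>s. \<gamma> s *\<^sub>R g s"
  let ?S = "\<Sum>i<n. c i *\<^sub>R h *\<^sub>R g (real i * h)"
  have "real n \<le> t / h" "t / h < real n + 1"
    using t h unfolding n_def by (simp_all add: floor_less_iff)
  then have a: "0 \<le> ?a" "?a \<le> t" "t - ?a \<le> h"
    using h by (auto simp: field_simps)
  \<comment> \<open>Both signs follow by evaluating the bounds at the point 0 of
    \<open>{0..t}\<close>.\<close>
  have M0: "0 \<le> M" and \<omega>0: "0 \<le> \<omega>"
    using order_trans[OF norm_ge_zero M[of 0]] order_trans[OF norm_ge_zero \<omega>[of 0 0]] t h by auto
  have head: "norm (integral {0..?a} ?f - ?S) \<le> \<omega> * ?a"
    using a c(1)[folded n_def] \<omega>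
    by (intro norm_integral_minus_sum_le \<gamma> h continuous_on_subset[OF g]) auto
  have "norm (integral {?a..t} ?f) \<le> M * (t - ?a)"
    using a by (intro norm_integral_le integrable_multiplier norm_multiplier_le M \<gamma> continuous_on_subset[OF g])
      (auto intro: order_trans[OF a(1)])
  also have "\<dots> \<le> M * h"
    using a M0 by (intro mult_left_mono)
  finally have tail: "norm (integral {?a..t} ?f) \<le> M * h" .
  have "norm (h *\<^sub>R g ?a) \<le> M * h"
    using h a M[of ?a] by (simp add: mult.commute)
  then have last: "norm (c n *\<^sub>R h *\<^sub>R g ?a) \<le> M * h"
    by (rule norm_multiplier_le[OF c(2)[folded n_def]])
  have "integral {0..t} ?f = integral {0..?a} ?f + integral {?a..t} ?f"
    using a by (intro Henstock_Kurzweil_Integration.integral_combine[symmetric]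
        integrable_multiplier \<gamma> g) auto
  then have "integral {0..t} ?f - (\<Sum>i\<le>n. c i *\<^sub>R h *\<^sub>R g (real i * h))
      = (integral {0..?a} ?f - ?S) + integral {?a..t} ?f - c n *\<^sub>R h *\<^sub>R g ?a"
    by (simp flip: lessThan_Suc_atMost)
  also have "norm \<dots> \<le> \<omega> * ?a + M * h + M * h"
    using head tail last by (smt (verit) norm_triangle_ineq norm_triangle_ineq4)
  also have "\<omega> * ?a \<le> \<omega> * t"
    using a \<omega>0 by (intro mult_left_mono)
  finally show ?thesis
    by (simp add: n_def)
qed

section \<open>Multiplier integrals: convexity, boundedness, distance to Riemann zonotopes\<close>

lemma convex_multiplier_integrals:
  assumes "continuous_on {0..t} g"
  shows "convex (multiplier_integrals g t)"
proof (rule convexI)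
  fix x y and u v :: real
  assume xy: "x \<in> multiplier_integrals g t" "y \<in> multiplier_integrals g t"
    and uv: "0 \<le> u" "0 \<le> v" "u + v = 1"
  from xy obtain \<gamma> \<delta> where \<gamma>: "\<gamma> \<in> borel_measurable borel" "\<And>s. \<bar>\<gamma> s\<bar> \<le> 1"
    and \<delta>: "\<delta> \<in> borel_measurable borel" "\<And>s. \<bar>\<delta> s\<bar> \<le> 1"
    and x: "x = integral {0..t} (\<lambda>s. \<gamma> s *\<^sub>R g s)" and y: "y = integral {0..t} (\<lambda>s. \<delta> s *\<^sub>R g s)"
    unfolding multiplier_integrals_def by blast
  have "((\<lambda>s. u *\<^sub>R \<gamma> s *\<^sub>R g s + v *\<^sub>R \<delta> s *\<^sub>R g s) has_integral u *\<^sub>R x + v *\<^sub>R y) {0..t}"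
    unfolding x y using integrable_multiplier[OF \<gamma> assms] integrable_multiplier[OF \<delta> assms]
    by (intro has_integral_add has_integral_cmul) auto
  then have "u *\<^sub>R x + v *\<^sub>R y = integral {0..t} (\<lambda>s. (u * \<gamma> s + v * \<delta> s) *\<^sub>R g s)"
    by (simp add: integral_unique scaleR_add_left)
  \<comment> \<open>The combined multiplier is admissible because \<open>{-1..1}\<close> is convex;
    the upper and lower bounds are checked separately.\<close>
  moreover have "\<bar>u * \<gamma> s + v * \<delta> s\<bar> \<le> 1" for s
    using convex_bound_le[OF abs_le_D1 abs_le_D1 uv, OF \<gamma>(2)[of s] \<delta>(2)[of s]]
      convex_bound_le[OF abs_le_D2 abs_le_D2 uv, OF \<gamma>(2)[of s] \<delta>(2)[of s]]
    by (simp add: abs_le_iff)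
  ultimately show "u *\<^sub>R x + v *\<^sub>R y \<in> multiplier_integrals g t"
    unfolding multiplier_integrals_def using \<gamma>(1) \<delta>(1)
    by (intro CollectI exI[of _ "\<lambda>s. u * \<gamma> s + v * \<delta> s"] conjI) auto
qed

lemma bounded_multiplier_integrals:
  assumes g: "continuous_on {0..t} g" and t: "t \<ge> 0"
  shows "bounded (multiplier_integrals g t)"
proof -
  obtain M where M: "\<And>s. s \<in> {0..t} \<Longrightarrow> norm (g s) \<le> M"
    using continuous_on_compact_bound[OF compact_Icc g] by metis
  show ?thesis
    unfolding bounded_iff multiplier_integrals_def
    using t by (auto intro!: exI[of _ "M * (t - 0)"] norm_integral_le integrable_multiplier g
        norm_multiplier_le M)
qed

lemma multiplier_integrals_nonempty: "multiplier_integrals g t \<noteq> {}"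
  unfolding multiplier_integrals_def by (auto intro: exI[of _ "\<lambda>_. 0"])

lemma zonotope_near_multiplier_integrals:
  fixes g :: "real \<Rightarrow> 'a::euclidean_space"
  assumes g: "continuous_on {0..t} g" and t: "t \<ge> 0" and h: "h > 0"
    and M: "\<And>s. s \<in> {0..t} \<Longrightarrow> norm (g s) \<le> M"
    and \<omega>: "\<And>s s'. s \<in> {0..t} \<Longrightarrow> s' \<in> {0..t} \<Longrightarrow> \<bar>s - s'\<bar> \<le> h \<Longrightarrow> norm (g s - g s') \<le> \<omega>"
  defines "Z \<equiv> zonotope (Suc (nat \<lfloor>t / h\<rfloor>)) (\<lambda>i. h *\<^sub>R g (real i * h))"
  shows "x \<in> multiplier_integrals g t \<Longrightarrow> infdist x Z \<le> \<omega> * t + 2 * M * h"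
    and "z \<in> Z \<Longrightarrow> infdist z (multiplier_integrals g t) \<le> \<omega> * t + 2 * M * h"
proof -
  assume "x \<in> multiplier_integrals g t"
  then obtain \<gamma> where \<gamma>: "\<gamma> \<in> borel_measurable borel" "\<And>s. \<bar>\<gamma> s\<bar> \<le> 1"
    and x: "x = integral {0..t} (\<lambda>s. \<gamma> s *\<^sub>R g s)"
    unfolding multiplier_integrals_def by blast
  \<comment> \<open>The mean of \<open>\<gamma>\<close> over cell \<open>i\<close>. The top cell
    reaches beyond \<open>t\<close>, but the bound by 1 holds there too.\<close>
  define c where "c i = integral {real i * h..real (Suc i) * h} \<gamma> / h" for i
  have c: "\<bar>c i\<bar> \<le> 1" for i
  proof -
    have "norm (integral {real i * h..real (Suc i) * h} \<gamma>) \<le> 1 * (real (Suc i) * h - real i * h)"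
      using h integrable_multiplier[OF \<gamma>, of _ _ "\<lambda>_. 1::real"]
      by (intro norm_integral_le) (auto simp: \<gamma>(2) algebra_simps)
    then show ?thesis
      using h by (simp add: c_def abs_divide algebra_simps)
  qed
  let ?z = "\<Sum>i\<le>nat \<lfloor>t / h\<rfloor>. c i *\<^sub>R h *\<^sub>R g (real i * h)"
  have "?z \<in> Z"
    unfolding Z_def lessThan_Suc_atMost[symmetric] by (rule zonotopeI) (rule c)
  moreover have "dist x ?z \<le> \<omega> * t + 2 * M * h"
    unfolding x dist_norm using h c
    by (intro norm_integral_minus_floor_sum_le \<gamma> g t M \<omega>) (auto simp: c_def)
  ultimately show "infdist x Z \<le> \<omega> * t + 2 * M * h"
    by (rule infdist_le2)
next
  assume "z \<in> Z"
  then obtain c :: "nat \<Rightarrow> real" where c: "\<And>i. i \<le> nat \<lfloor>t / h\<rfloor> \<Longrightarrow> \<bar>c i\<bar> \<le> 1"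
    and z: "z = (\<Sum>i\<le>nat \<lfloor>t / h\<rfloor>. c i *\<^sub>R h *\<^sub>R g (real i * h))"
    unfolding Z_def zonotope_def lessThan_Suc_atMost by (auto simp: abs_le_iff less_Suc_eq_le)
  \<comment> \<open>Extension by 0 keeps the step function \<open>\<gamma>\<close> bounded by 1 on
    the whole line; for negative \<open>s\<close>, \<open>nat\<close> sends the floor to 0, so the
    value is \<open>c' 0\<close>.\<close>
  define c' where "c' i = (if i \<le> nat \<lfloor>t / h\<rfloor> then c i else 0)" for i
  define \<gamma> where "\<gamma> s = c' (nat \<lfloor>s / h\<rfloor>)" for s
  have \<gamma>: "\<gamma> \<in> borel_measurable borel" "\<bar>\<gamma> s\<bar> \<le> 1" for s
    unfolding \<gamma>_def by (measurable, simp add: c'_def c)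
  have \<gamma>_int: "integral {real i * h..real (Suc i) * h} \<gamma> = c i * h" if i: "i < nat \<lfloor>t / h\<rfloor>" for i
  proof -
    \<comment> \<open>At its right end point the floor already selects the next cell; this single
      point does not affect the integral.\<close>
    have "\<gamma> s = c i" if "s \<in> {real i * h..real (Suc i) * h} - {real (Suc i) * h}" for s
    proof -
      have "real i \<le> s / h" "s / h < real i + 1"
        using that h by (auto simp: field_simps)
      then have "\<lfloor>s / h\<rfloor> = int i"
        by (simp add: floor_eq_iff)
      then show ?thesis
        using i by (simp add: \<gamma>_def c'_def)
    qed
    then have "integral {real i * h..real (Suc i) * h} \<gamma>
        = integral {real i * h..real (Suc i) * h} (\<lambda>_. c i)"
      by (intro integral_spike[where S = "{real (Suc i) * h}"]) auto
    then show ?thesis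
      using h by (simp add: algebra_simps)
  qed
  have "integral {0..t} (\<lambda>s. \<gamma> s *\<^sub>R g s) \<in> multiplier_integrals g t"
    unfolding multiplier_integrals_def using \<gamma> by blast
  moreover have "dist (integral {0..t} (\<lambda>s. \<gamma> s *\<^sub>R g s)) z \<le> \<omega> * t + 2 * M * h"
    unfolding z dist_norm using c
    by (intro norm_integral_minus_floor_sum_le \<gamma> g t h M \<omega> \<gamma>_int) auto
  ultimately show "infdist z (multiplier_integrals g t) \<le> \<omega> * t + 2 * M * h"
    by (intro infdist_le2) (simp_all add: dist_commute)
qed

section \<open>Convergence of the Riemann zonotopes\<close>

lemma set_valued_sum_eq_zonotope:
  "(\<Sum>i\<le>n. (*\<^sub>R) h ` symmetric_segment (g (real i * h)))
     = zonotope (Suc n) (\<lambda>i. h *\<^sub>R g (real i * h))"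
  by (simp add: scaleR_image_symmetric_segment sum_symmetric_segment_eq_zonotope)

lemma compact_zonotope_Suc:
  fixes v :: "nat \<Rightarrow> 'a::real_normed_vector"
  shows "compact (zonotope (Suc n) v)"
  unfolding sum_symmetric_segment_eq_zonotope[symmetric]
  by (intro compact_set_sum compact_symmetric_segment)

text \<open>Uniform continuity of \<open>g\<close> controls the term \<open>\<omega> * t\<close>,
  and a small \<open>h\<close> the term \<open>2 * M * h\<close>. The closure makes the bounded
  limit set compact and preserves both distance estimates.\<close>

theorem has_set_valued_integral_symmetric_segment:
  fixes g :: "real \<Rightarrow> 'a::euclidean_space"
  assumes g: "continuous_on {0..t} g" and t: "t \<ge> 0"
  shows "has_set_valued_integral (\<lambda>s. symmetric_segment (g s)) t (closure (multiplier_integrals g t))"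
proof -
  let ?L = "multiplier_integrals g t" and ?K = "closure (multiplier_integrals g t)"
  let ?Z = "\<lambda>h. zonotope (Suc (nat \<lfloor>t / h\<rfloor>)) (\<lambda>i. h *\<^sub>R g (real i * h))"
  have K: "compact ?K" "?K \<noteq> {}"
    using bounded_multiplier_integrals[OF assms] multiplier_integrals_nonempty by auto
  obtain M where "0 \<le> M" and M: "\<And>s. s \<in> {0..t} \<Longrightarrow> norm (g s) \<le> M"
    using continuous_on_compact_bound[OF compact_Icc g] by metis
  have "((\<lambda>h. hausdorff_distance (?Z h) ?K) \<longlongrightarrow> 0) (at_right 0)"
  proof (rule tendstoI)
    fix e :: real assume "e > 0"
    \<comment> \<open>Each error term receives \<open>e / 2\<close>. Adding 1 to \<open>t\<close>
      here, and to \<open>M\<close> in \<open>r\<close> below, avoids division by zero.\<close>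
    define \<omega> where "\<omega> = e / (2 * (t + 1))"
    have "\<omega> > 0" "\<omega> * t < e / 2"
      using \<open>e > 0\<close> t by (auto simp: \<omega>_def field_simps)
    obtain \<delta> where "\<delta> > 0"
      and \<delta>: "\<And>s s'. s \<in> {0..t} \<Longrightarrow> s' \<in> {0..t} \<Longrightarrow> dist s s' < \<delta> \<Longrightarrow> dist (g s) (g s') < \<omega>"
      using compact_uniformly_continuous[OF g compact_Icc] \<open>\<omega> > 0\<close>
      unfolding uniformly_continuous_on_def by (metis dist_commute)
    define r where "r = min \<delta> (e / (4 * (M + 1)))"
    have "r > 0"
      using \<open>\<delta> > 0\<close> \<open>e > 0\<close> \<open>0 \<le> M\<close> by (simp add: r_def)
    have "dist (hausdorff_distance (?Z h) ?K) 0 < e" if h: "0 < h" "h < r" for h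
    proof -
      have \<omega>: "norm (g s - g s') \<le> \<omega>" if "s \<in> {0..t}" "s' \<in> {0..t}" "\<bar>s - s'\<bar> \<le> h" for s s'
        using \<delta>[OF that(1,2)] that(3) h by (simp add: dist_norm r_def)
      have near1: "infdist x (?Z h) \<le> \<omega> * t + 2 * M * h" if "x \<in> ?L" for x
        by (rule zonotope_near_multiplier_integrals(1)[OF g t h(1) M \<omega> that])
      have near2: "infdist z ?L \<le> \<omega> * t + 2 * M * h" if "z \<in> ?Z h" for z
        by (rule zonotope_near_multiplier_integrals(2)[OF g t h(1) M \<omega> that])
      have "hausdorff_distance (?Z h) ?K \<le> \<omega> * t + 2 * M * h"
      proof (rule hausdorff_distance_leI)
        show "infdist z ?K \<le> \<omega> * t + 2 * M * h" if "z \<in> ?Z h" for z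
          using near2[OF that] infdist_mono[OF closure_subset multiplier_integrals_nonempty]
          by (meson order_trans)
        \<comment> \<open>The estimate is known on \<open>?L\<close> only; it passes to the closure
          by continuity of \<open>infdist\<close>.\<close>
        fix x assume "x \<in> ?K"
        show "infdist x (?Z h) \<le> \<omega> * t + 2 * M * h"
        proof (rule continuous_le_on_closure[OF _ \<open>x \<in> ?K\<close>])
          show "continuous_on ?K (\<lambda>x. infdist x (?Z h))"
            by (intro continuous_intros)
        qed (rule near1)
      qed (use zonotope_nonempty K in auto)
      also have "2 * M * h \<le> 2 * (M + 1) * h"
        using h by simp
      also have "\<dots> < 2 * (M + 1) * (e / (4 * (M + 1)))"
        using h \<open>0 \<le> M\<close> by (intro mult_strict_left_mono) (auto simp: r_def)
      also have "\<dots> = e / 2"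
        using \<open>0 \<le> M\<close> by (simp add: field_simps)
      finally have "hausdorff_distance (?Z h) ?K < e"
        using \<open>\<omega> * t < e / 2\<close> by simp
      moreover have "0 \<le> hausdorff_distance (?Z h) ?K"
        by (intro hausdorff_distance_nonneg compact_zonotope_Suc K zonotope_nonempty)
      ultimately show ?thesis by simp
    qed
    then show "\<forall>\<^sub>F h in at_right 0. dist (hausdorff_distance (?Z h) ?K) 0 < e"
      using \<open>r > 0\<close> by (auto simp: eventually_at_right_field)
  qed
  then show ?thesis
    unfolding has_set_valued_integral_def hausdorff_tendsto_def set_valued_sum_eq_zonotope
    using K by (auto simp: compact_zonotope_Suc zonotope_nonempty)
qed

theorem zonoid_set_valued_integral:
  fixes g :: "real \<Rightarrow> 'a::euclidean_space"
  assumes g: "continuous_on {0..t} g" and t: "t \<ge> 0"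
  shows "zonoid (set_valued_integral (\<lambda>s. symmetric_segment (g s)) t)"
proof -
  let ?K = "closure (multiplier_integrals g t)"
  let ?Z = "\<lambda>h. zonotope (Suc (nat \<lfloor>t / h\<rfloor>)) (\<lambda>i. h *\<^sub>R g (real i * h))"
  note int = has_set_valued_integral_symmetric_segment[OF assms]
  then have lim: "hausdorff_tendsto ?Z ?K (at_right 0)"
    by (simp only: has_set_valued_integral_def set_valued_sum_eq_zonotope)
  \<comment> \<open>A positive null sequence of step sizes turns the one-sided limit into the
    sequence of zonotopes that \<open>zonoid\<close> asks for.\<close>
  define u where "u n = inverse (real (Suc n))" for n
  have "filterlim u (at_right 0) sequentially"
    unfolding filterlim_at u_def using LIMSEQ_inverse_real_of_nat by auto
  then have "hausdorff_tendsto (\<lambda>n. ?Z (u n)) ?K sequentially"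
    by (rule hausdorff_tendsto_compose[OF lim])
  moreover have "\<forall>n. is_zonotope (?Z (u n))"
    unfolding is_zonotope_def by blast
  moreover have "compact ?K" "convex ?K"
    using lim convex_multiplier_integrals[OF g] by (auto simp: hausdorff_tendsto_def)
  ultimately show ?thesis
    unfolding set_valued_integral_eqI[OF int] zonoid_def
    by (intro conjI exI[of _ "\<lambda>n. ?Z (u n)"])
qed

section \<open>The exponential of a nilpotent shift\<close>

lemma matrix_power_scaleR: "matrix_power (s *\<^sub>R A) k = s ^ k *\<^sub>R matrix_power A k"
  by (induction k) (simp_all add: matrix_scalar_ac flip: scalar_matrix_assoc)

text \<open>All terms from index \<open>d\<close> on vanish, so the series is a finite sum.\<close>

lemma matrix_exp_nilpotent:
  assumes "\<And>k. k \<ge> d \<Longrightarrow> matrix_power A k = 0"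
  shows "matrix_exp (s *\<^sub>R A) = (\<Sum>k<d. (s ^ k / fact k) *\<^sub>R matrix_power A k)"
proof -
  have "matrix_exp (s *\<^sub>R A) = (\<Sum>k<d. (1 / fact k) *\<^sub>R matrix_power (s *\<^sub>R A) k)"
    unfolding matrix_exp_def by (rule suminf_finite) (auto simp: matrix_power_scaleR assms)
  then show ?thesis
    by (simp add: matrix_power_scaleR)
qed

lemma sum_matrix_vector_mult: "(\<Sum>i\<in>I. M i) *v x = (\<Sum>i\<in>I. M i *v x)"
  by (induction I rule: infinite_finite_induct) (simp_all add: matrix_vector_mult_add_rdistrib)

context
  fixes d :: nat and ix :: "nat \<Rightarrow> 'd::finite" and A :: "real^'d^'d"
  assumes ix: "bij_betw ix {1..d} UNIV"
    and A: "column (ix 1) A = 0"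
      "\<forall>k\<in>{1..d - 1}. column (ix (k + 1)) A = axis (ix k) 1"
begin

text \<open>Applying \<open>A\<close> to a basis vector reads off a column, so each application
  lowers the index by one until the first basis vector is sent to 0.\<close>

lemma shift_power_mult_axis:
  assumes "j \<in> {1..d}"
  shows "matrix_power A k *v axis (ix j) 1 = (if k < j then axis (ix (j - k)) 1 else 0)"
proof (induction k)
  case 0
  then show ?case using assms by simp
next
  case (Suc k)
  have "matrix_power A (Suc k) *v axis (ix j) 1 = A *v (matrix_power A k *v axis (ix j) 1)"
    by (simp add: matrix_vector_mul_assoc)
  also have "\<dots> = A *v (if k < j then axis (ix (j - k)) 1 else 0)"
    by (simp only: Suc.IH)
  also have "\<dots> = (if Suc k < j then axis (ix (j - Suc k)) 1 else 0)"
  proof (cases "Suc k < j")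
    case True
    then have "column (ix (j - Suc k + 1)) A = axis (ix (j - Suc k)) 1"
      using assms by (intro A(2)[rule_format]) auto
    with True show ?thesis
      by (simp add: matrix_vector_mult_basis Suc_diff_Suc)
  next
    case False
    \<comment> \<open>If \<open>k < j\<close>, the vector reached is the first basis vector, which
      \<open>A\<close> kills; otherwise it is already 0.\<close>
    then have "j - k = 1" if "k < j"
      using that by simp
    with False A(1) show ?thesis
      by (simp add: matrix_vector_mult_basis)
  qed
  finally show ?case .
qed

text \<open>After \<open>d\<close> shifts every basis vector has been sent to 0, so all columns of
  the power vanish.\<close>

lemma shift_power_eq_0:
  assumes "k \<ge> d"
  shows "matrix_power A k = 0"
proof -
  have "matrix_power A k $ i $ l = 0" for i l
  proof -
    obtain j where j: "j \<in> {1..d}" "l = ix j"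
      using bij_betw_imp_surj_on[OF ix] by blast
    then have "column l (matrix_power A k) = 0"
      using shift_power_mult_axis[of j k] assms by (simp add: matrix_vector_mult_basis)
    then show ?thesis
      by (simp add: column_def vec_eq_iff)
  qed
  then show ?thesis
    by (simp add: vec_eq_iff)
qed

text \<open>The power \<open>i\<close> of \<open>A\<close> moves the last basis vector to position
  \<open>d - i\<close>, so only the summand \<open>i = d - k\<close> reaches coordinate
  \<open>k\<close>.\<close>

lemma shift_exp_mult_axis_nth:
  assumes "d \<ge> 1" "k \<in> {1..d}"
  shows "(matrix_exp (s *\<^sub>R A) *v axis (ix d) 1) $ ix k = s ^ (d - k) / fact (d - k)"
proof -
  have nth: "axis (ix (d - i)) (1::real) $ ix k = (if i = d - k then 1 else 0)" if "i < d" for i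
  proof -
    have "ix (d - i) = ix k \<longleftrightarrow> d - i = k"
      using that assms by (intro inj_on_eq_iff[OF bij_betw_imp_inj_on[OF ix]]) auto
    then show ?thesis
      using that assms by (auto simp: axis_def)
  qed
  have "matrix_exp (s *\<^sub>R A) *v axis (ix d) 1
      = (\<Sum>i<d. (s ^ i / fact i) *\<^sub>R (matrix_power A i *v axis (ix d) 1))"
    by (simp add: matrix_exp_nilpotent[OF shift_power_eq_0] sum_matrix_vector_mult
        scaleR_matrix_vector_assoc)
  also have "\<dots> = (\<Sum>i<d. (s ^ i / fact i) *\<^sub>R axis (ix (d - i)) 1)"
    using assms(1) by (intro sum.cong) (simp_all add: shift_power_mult_axis)
  finally have "(matrix_exp (s *\<^sub>R A) *v axis (ix d) 1) $ ix k
      = (\<Sum>i<d. s ^ i / fact i * axis (ix (d - i)) 1 $ ix k)"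
    by (simp add: sum_component)
  also have "\<dots> = (\<Sum>i<d. if i = d - k then s ^ i / fact i else 0)"
    by (intro sum.cong) (simp_all add: nth)
  also have "\<dots> = s ^ (d - k) / fact (d - k)"
    using assms by (simp add: sum.delta)
  finally show ?thesis .
qed

end

text \<open>Once \<open>matrix_exp (s *\<^sub>R A) *v b = \<xi> s\<close> is known, everything is an
  instance of the results for continuous curves. The conjunct with
  \<open>has_set_valued_integral\<close> states that the limit exists, so that
  \<open>set_valued_integral\<close> denotes it and not an unspecified set.\<close>

theorem proposition2:
  fixes d :: nat
    and t :: real
    and ix :: "nat \<Rightarrow> 'd::finite"  \<comment> \<open>numbering of the coordinates by 1, ..., d\<close>
    and A :: "real^'d^'d"
    and b :: "real^'d"
    and \<xi> :: "real \<Rightarrow> real^'d"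
  assumes dim: "CARD('d) = d" "d \<ge> 2"
    and ix: "bij_betw ix {1..d} UNIV"
    and t: "t > 0"
    and A: "column (ix 1) A = 0"
           "\<forall>k\<in>{1..d - 1}. column (ix (k + 1)) A = axis (ix k) 1"
    and b: "b = axis (ix d) 1"
    and xi: "\<forall>s. \<forall>k\<in>{1..d}. \<xi> s $ ix k = s ^ (d - k) / fact (d - k)"
  shows
    "(\<forall>n::nat. n \<ge> 1 \<longrightarrow>
        (\<Sum>i\<le>n. symmetric_segment (matrix_exp ((real i * t / real n) *\<^sub>R A) *v b))
          = zonotope (n + 1) (\<lambda>i. \<xi> (real i * t / real n)) \<and>
        (\<forall>y. support_function (zonotope (n + 1) (\<lambda>i. \<xi> (real i * t / real n))) y
          = (\<Sum>i\<le>n. \<bar>y \<bullet> \<xi> (real i * t / real n)\<bar>)))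
     \<and> has_set_valued_integral (\<lambda>s. symmetric_segment (matrix_exp (s *\<^sub>R A) *v b)) t
         (set_valued_integral (\<lambda>s. symmetric_segment (matrix_exp (s *\<^sub>R A) *v b)) t)
     \<and> zonoid (set_valued_integral (\<lambda>s. symmetric_segment (matrix_exp (s *\<^sub>R A) *v b)) t)"
proof -
  have nth: "(matrix_exp (s *\<^sub>R A) *v b) $ ix k = \<xi> s $ ix k" if "k \<in> {1..d}" for s k
    using shift_exp_mult_axis_nth[OF ix A _ that] dim(2) xi that by (simp add: b)
  have exp_eq: "matrix_exp (s *\<^sub>R A) *v b = \<xi> s" for s
  proof (rule vec_eq_iff[THEN iffD2, rule_format])
    fix i
    obtain k where "k \<in> {1..d}" "i = ix k"
      using bij_betw_imp_surj_on[OF ix] by blast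
    with nth show "(matrix_exp (s *\<^sub>R A) *v b) $ i = \<xi> s $ i" by simp
  qed
  have "continuous_on {0..t} (\<lambda>s. \<xi> s $ i)" for i
  proof -
    obtain k where "k \<in> {1..d}" "i = ix k"
      using bij_betw_imp_surj_on[OF ix] by blast
    then show ?thesis
      using xi by (auto intro!: continuous_intros)
  qed
  then have "continuous_on {0..t} (\<lambda>s. \<chi> i. \<xi> s $ i)"
    by (rule continuous_on_vec_lambda)
  then have cont: "continuous_on {0..t} \<xi>"
    by simp
  note int = has_set_valued_integral_symmetric_segment[OF cont less_imp_le[OF t]]
  show ?thesis
    using int zonoid_set_valued_integral[OF cont less_imp_le[OF t]]
    by (simp add: exp_eq set_valued_integral_eqI[OF int] sum_symmetric_segment_eq_zonotope
        support_function_zonotope lessThan_Suc_atMost)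
qed

end
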